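(* There exist a family of graphs $(G_k)_{k=1}^\infty$ and an increasing unbounded sequence $(x_k)_{k=1}^\infty$ of positive integers such that $\lim_{k\to\infty} x_{k+1}/x_k = 1$, and $$\chi_{\mathrm{lin}}(G_k)\le x_k \quad\text{and}\quad \chi_{\mathrm{cen}}(G_k)\ge\left(\frac12-o(1)\right)\frac{x_k^2}{\log x_k},$$ where $o(1)$ denotes a real sequence tending to $0$ as $k\to\infty$.
   Context: All graphs are finite, simple, and undirected; connected graphs and paths are assumed to be nonnull (to have at least one vertex). All colorings are vertex-colorings (arbitrary assignments of colors to the vertices). $\log$ is the base-$2$ logarithm. For a coloring $\varphi$ of a graph $G$, a vertex $v$ of a subgraph $H$ of $G$ is a $\varphi$-center of $H$ if the color $\varphi(v)$ appears exactly once in $H$. The coloring $\varphi$ is centered if every connected subgraph of $G$ has a $\varphi$-center; it is linear if every path in $G$ (a path as a subgraph, not necessarily induced) has a $\varphi$-center. $\chi_{\mathrm{cen}}(G)$ (respectively $\chi_{\mathrm{lin}}(G)$) is the minimum number of colors in a centered (respectively linear) coloring of $G$. The second inequality, involving $\log x_k$ in a denominator, is an asymptotic statement as $k\to\infty$ (terms with $x_k=1$ are irrelevant). *)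

theory Defs
  imports Complex_Main "Graph_Theory.Graph_Theory"
begin

text \<open>
  Finite simple undirected graphs are represented as \<^locale>\<open>pair_graph\<close>s: finite loop-free digraphs
  with a symmetric arc relation.  As \<^const>\<open>subgraph\<close> also admits non-symmetric subdigraphs, subgraphs
  are additionally required to be \<^locale>\<open>pair_graph\<close>s below.  \<^const>\<open>Digraph_Component.connected\<close>
  and \<^const>\<open>vpath\<close> both entail non-emptiness.
\<close>

text \<open>
  Whether \<open>v\<close> is a center of a subgraph depends only on the vertex set \<open>X\<close> of that subgraph.
\<close>

definition is_center :: "('a \<Rightarrow> 'c) \<Rightarrow> 'a set \<Rightarrow> 'a \<Rightarrow> bool" where
  "is_center \<phi> X v \<longleftrightarrow> v \<in> X \<and> (\<forall>u\<in>X. \<phi> u = \<phi> v \<longrightarrow> u = v)"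

definition centered_coloring :: "'a pair_pre_digraph \<Rightarrow> ('a \<Rightarrow> 'c) \<Rightarrow> bool" where
  "centered_coloring G \<phi> \<longleftrightarrow>
     (\<forall>H. pair_graph H \<and> subgraph (with_proj H) (with_proj G) \<and>
          Digraph_Component.connected (with_proj H)
        \<longrightarrow> (\<exists>v. is_center \<phi> (pverts H) v))"

definition linear_coloring :: "'a pair_pre_digraph \<Rightarrow> ('a \<Rightarrow> 'c) \<Rightarrow> bool" where
  "linear_coloring G \<phi> \<longleftrightarrow> (\<forall>p. vpath p (with_proj G) \<longrightarrow> (\<exists>v. is_center \<phi> (set p) v))"

text \<open>
  Since the graphs are finite, natural numbers suffice as colors; only colors used on vertices of
  the graph are counted.
\<close>

definition chi_cen :: "'a pair_pre_digraph \<Rightarrow> nat" where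
  "chi_cen G = (LEAST k. \<exists>\<phi> :: 'a \<Rightarrow> nat. centered_coloring G \<phi> \<and> card (\<phi> ` pverts G) = k)"

definition chi_lin :: "'a pair_pre_digraph \<Rightarrow> nat" where
  "chi_lin G = (LEAST k. \<exists>\<phi> :: 'a \<Rightarrow> nat. linear_coloring G \<phi> \<and> card (\<phi> ` pverts G) = k)"

text \<open>Both minima range over non-empty sets, because an injective coloring qualifies.\<close>

lemma inj_on_centered_coloring:
  assumes "inj_on \<phi> (pverts G)"
  shows "centered_coloring G \<phi>"
  unfolding centered_coloring_def
proof (intro allI impI)
  fix H assume H: "pair_graph H \<and> subgraph (with_proj H) (with_proj G) \<and>
    Digraph_Component.connected (with_proj H)"
  then have sub: "pverts H \<subseteq> pverts G" by (simp add: subgraph_def)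
  from H obtain v where "v \<in> pverts H"
    unfolding Digraph_Component.connected_def strongly_connected_def mk_symmetric_def by auto
  with sub assms have "is_center \<phi> (pverts H) v"
    unfolding is_center_def inj_on_def by blast
  then show "\<exists>v. is_center \<phi> (pverts H) v" ..
qed

lemma inj_on_linear_coloring:
  assumes "inj_on \<phi> (pverts G)"
  shows "linear_coloring G \<phi>"
  unfolding linear_coloring_def
proof (intro allI impI)
  fix p assume "vpath p (with_proj G)"
  then have sub: "set p \<subseteq> pverts G" and "p \<noteq> []" by (simp_all add: vpath_def vwalk_def)
  then have "hd p \<in> set p" by simp
  with sub assms have "is_center \<phi> (set p) (hd p)"
    unfolding is_center_def inj_on_def by blast
  then show "\<exists>v. is_center \<phi> (set p) v" ..
qed

lemma chi_cen_attained:
  assumes "finite (pverts G)"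
  shows "\<exists>\<phi> :: 'a \<Rightarrow> nat. centered_coloring (G :: 'a pair_pre_digraph) \<phi> \<and> card (\<phi> ` pverts G) = chi_cen G"
proof -
  from assms obtain \<phi> :: "'a \<Rightarrow> nat" where "inj_on \<phi> (pverts G)"
    using finite_imp_inj_to_nat_seg[OF assms] by auto
  then have "centered_coloring G \<phi> \<and> card (\<phi> ` pverts G) = card (\<phi> ` pverts G)"
    by (simp add: inj_on_centered_coloring)
  then have "\<exists>k. \<exists>\<phi> :: 'a \<Rightarrow> nat. centered_coloring G \<phi> \<and> card (\<phi> ` pverts G) = k"
    by (intro exI)
  then show ?thesis unfolding chi_cen_def by (rule LeastI_ex)
qed

lemma chi_lin_attained:
  assumes "finite (pverts G)"
  shows "\<exists>\<phi> :: 'a \<Rightarrow> nat. linear_coloring (G :: 'a pair_pre_digraph) \<phi> \<and> card (\<phi> ` pverts G) = chi_lin G"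
proof -
  from assms obtain \<phi> :: "'a \<Rightarrow> nat" where "inj_on \<phi> (pverts G)"
    using finite_imp_inj_to_nat_seg[OF assms] by auto
  then have "linear_coloring G \<phi> \<and> card (\<phi> ` pverts G) = card (\<phi> ` pverts G)"
    by (simp add: inj_on_linear_coloring)
  then have "\<exists>k. \<exists>\<phi> :: 'a \<Rightarrow> nat. linear_coloring G \<phi> \<and> card (\<phi> ` pverts G) = k"
    by (intro exI)
  then show ?thesis unfolding chi_lin_def by (rule LeastI_ex)
qed

end

theory Submission
  imports Defs "HOL-Library.Nat_Bijection" "HOL-Real_Asymp.Real_Asymp"
begin

text \<open>
  Let a graph be linearly colored with \<open>n \<le> 2 ^ b\<close> colors. Take a rainbow clique on these \<open>n\<close>
  colors, and behind every clique vertex \<open>v\<close> hang a copy of the graph through a chain that carries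
  fresh colors: a subset of \<open>b\<close> new colors identifying \<open>v\<close>, and then a marker color next to the
  copy. A path avoiding all markers is confined to a copy or has a center on the clique or on a chain;
  a path through one marker has that marker as center; and a path cannot meet more than two
  branches, so on a path through two markers any color that distinguishes the two chains is unique.
  So \<open>b + 1\<close> new colors suffice for a linear coloring. Centered colorings need \<open>n - 1\<close> new
  colors: any union of branches is connected, so its center may be found and the branch
  containing it deleted, \<open>n - 1\<close> times over, before a single branch is left.
  Iterating this about \<open>k / log k\<close> times reaches \<open>k\<close> linear colors, while the numbers of centered
  colors add up to about \<open>k\<^sup>2 / (2 log k)\<close>.
\<close>

section \<open>Connectivity and colorings on bare vertex and edge sets\<close>

definition connected_in :: "('a \<times> 'a) set \<Rightarrow> 'a set \<Rightarrow> bool" where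
  "connected_in E X \<longleftrightarrow> X \<noteq> {} \<and> (\<forall>x\<in>X. \<forall>y\<in>X. (x, y) \<in> (E \<inter> X \<times> X)\<^sup>*)"

definition linear_on :: "'a set \<Rightarrow> ('a \<times> 'a) set \<Rightarrow> ('a \<Rightarrow> 'c) \<Rightarrow> bool" where
  "linear_on V E \<phi> \<longleftrightarrow>
     (\<forall>p. p \<noteq> [] \<longrightarrow> distinct p \<longrightarrow> set p \<subseteq> V \<longrightarrow> successively (\<lambda>x y. (x, y) \<in> E) p \<longrightarrow>
       (\<exists>v. is_center \<phi> (set p) v))"

definition centered_on :: "'a set \<Rightarrow> ('a \<times> 'a) set \<Rightarrow> ('a \<Rightarrow> 'c) \<Rightarrow> bool" where
  "centered_on V E \<phi> \<longleftrightarrow> (\<forall>X\<subseteq>V. connected_in E X \<longrightarrow> (\<exists>v. is_center \<phi> X v))"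

text \<open>The statement that is iterated: \<open>n\<close> bounds the colors of one linear
  coloring from above, \<open>L\<close> those of all centered colorings from below. Vertices are
  natural numbers so that each level can be encoded in the same type as the previous one. The graph
  has to be connected because unions of branches must be connected one level up.\<close>

definition realizes :: "nat \<Rightarrow> nat \<Rightarrow> bool" where
  "realizes n L \<longleftrightarrow>
     (\<exists>(V :: nat set) E \<phi>. finite V \<and> E \<subseteq> V \<times> V \<and> sym E \<and> irrefl E \<and> connected_in E V \<and>
        \<phi> ` V \<subseteq> {..<n} \<and> linear_on V E \<phi> \<and>
        (\<forall>\<psi> :: nat \<Rightarrow> nat. centered_on V E \<psi> \<longrightarrow> L \<le> card (\<psi> ` V)))"

lemma connected_in_via:
  assumes "sym E" and "r \<in> X" and reach: "\<And>x. x \<in> X \<Longrightarrow> (x, r) \<in> (E \<inter> X \<times> X)\<^sup>*"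
  shows "connected_in E X"
proof -
  have "sym ((E \<inter> X \<times> X)\<^sup>*)"
    using assms(1) by (intro sym_rtrancl) (auto simp: sym_def)
  then have "(r, x) \<in> (E \<inter> X \<times> X)\<^sup>*" if "x \<in> X" for x
    using reach[OF that] by (rule symD)
  then show ?thesis
    using assms(2) reach unfolding connected_in_def by (blast intro: rtrancl_trans)
qed

section \<open>Paths crossing the boundary of a vertex set\<close>

text \<open>The path follows \<open>C\<close> from position \<open>i\<close> until it first steps
  out, and the vertex before that step can only be \<open>t\<close>. The bounds on \<open>k\<close>
  record the place of the crossing, which matters when two crossings are compared.\<close>

lemma successively_crosses:
  assumes "successively R p" "i < j" "j < length p" "p ! i \<in> C" "p ! j \<notin> C"
    and exit: "\<And>x y. R x y \<Longrightarrow> x \<in> C \<Longrightarrow> y \<notin> C \<Longrightarrow> x = t"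
  shows "\<exists>k. i \<le> k \<and> k < j \<and> p ! k = t"
  using assms(2-5)
proof (induction "j - i" arbitrary: i)
  case 0
  then show ?case by simp
next
  case (Suc d)
  have step: "R (p ! i) (p ! Suc i)"
    using assms(1) Suc.prems by (auto simp: successively_conv_nth)
  show ?case
  proof (cases "p ! Suc i \<in> C")
    case False
    then show ?thesis using exit[OF step] Suc.prems by auto
  next
    case True
    then have "Suc i < j" using Suc.prems by (metis Suc_lessI)
    then show ?thesis using Suc.hyps(1)[of "Suc i"] Suc.hyps(2) True Suc.prems
      by (metis Suc_diff_Suc Suc_inject Suc_leD Suc_lessD)
  qed
qed

lemma successively_crosses_back:
  assumes "successively R p" "i < j" "j < length p" "p ! j \<in> C" "p ! i \<notin> C"
    and exit: "\<And>x y. R x y \<Longrightarrow> y \<in> C \<Longrightarrow> x \<notin> C \<Longrightarrow> y = t"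
  shows "\<exists>k. i < k \<and> k \<le> j \<and> p ! k = t"
proof -
  let ?q = "rev p" and ?l = "length p"
  have "successively (\<lambda>x y. R y x) ?q" using assms(1) by (simp add: successively_rev)
  moreover have "?q ! (?l - Suc j) = p ! j" "?q ! (?l - Suc i) = p ! i"
    using assms(2,3) by (auto simp: rev_nth)
  moreover have "?l - Suc j < ?l - Suc i" "?l - Suc i < length ?q"
    using assms(2,3) by auto
  ultimately obtain k where k: "?l - Suc j \<le> k" "k < ?l - Suc i" "?q ! k = t"
    using successively_crosses[of "\<lambda>x y. R y x" ?q "?l - Suc j" "?l - Suc i" C t] assms(4,5) exit
    by metis
  then have "p ! (?l - Suc k) = t" by (simp add: rev_nth)
  with k assms(2,3) show ?thesis by (intro exI[of _ "?l - Suc k"]) auto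
qed

text \<open>The two orders of \<open>x\<close> and \<open>y\<close> on the path are the two crossing
  lemmas; symmetry of \<open>R\<close> turns the exit condition into an entry condition.\<close>

lemma successively_separator:
  assumes "successively R p" "symp R" "x \<in> set p" "y \<in> set p" "x \<in> C" "y \<notin> C"
    and exit: "\<And>x y. R x y \<Longrightarrow> x \<in> C \<Longrightarrow> y \<notin> C \<Longrightarrow> x = t"
  shows "t \<in> set p"
proof -
  from assms obtain i j where ij: "i < length p" "j < length p" "p ! i = x" "p ! j = y"
    by (metis in_set_conv_nth)
  with assms have "i \<noteq> j" by auto
  then consider "i < j" | "j < i" by linarith
  then show ?thesis
  proof cases
    case 1
    then show ?thesis
      using successively_crosses[of R p i j C t] assms ij by (metis nth_mem order.strict_trans)
  next
    case 2
    have "\<exists>k. j < k \<and> k \<le> i \<and> p ! k = t"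
      by (rule successively_crosses_back[OF assms(1) 2 ij(1)])
         (use assms ij exit in \<open>auto dest: sympD\<close>)
    then show ?thesis using ij by (metis nth_mem order.strict_trans1)
  qed
qed

section \<open>One level of the construction\<close>

text \<open>
  One level of the construction: a clique on \<open>chn v 0\<close> for \<open>v < n\<close>; from each of its vertices a chain
  \<open>chn v 0, \<dots>, chn v (last_pos v)\<close> whose inner colors spell the subset \<open>F v\<close> of \<open>{..<b}\<close> and whose
  last vertex has the marker color \<open>n + b\<close>; and behind it a copy of the previous graph.
\<close>

definition chn :: "nat \<Rightarrow> nat \<Rightarrow> nat" where "chn v j = prod_encode (v, sum_encode (Inl j))"
definition cpy :: "nat \<Rightarrow> nat \<Rightarrow> nat" where "cpy v w = prod_encode (v, sum_encode (Inr w))"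

lemma chn_cpy_simps [simp]:
  "chn v j = chn v' j' \<longleftrightarrow> v = v' \<and> j = j'"
  "cpy v w = cpy v' w' \<longleftrightarrow> v = v' \<and> w = w'"
  "chn v j \<noteq> cpy v' w" "cpy v' w \<noteq> chn v j"
  by (auto simp: chn_def cpy_def sum_encode_eq)

locale branch_extension =
  fixes V :: "nat set" and E :: "(nat \<times> nat) set" and \<phi> :: "nat \<Rightarrow> nat"
    and root n b :: nat and F :: "nat \<Rightarrow> nat set"
  assumes finite_V: "finite V" and E_sub: "E \<subseteq> V \<times> V" and sym_E: "sym E" and irrefl_E: "irrefl E"
    and root: "root \<in> V" and connected_V: "connected_in E V"
    and colors: "\<phi> ` V \<subseteq> {..<n}" and linear: "linear_on V E \<phi>"
    and inj_F: "inj_on F {..<n}" and F_sub: "\<And>v. v < n \<Longrightarrow> F v \<subseteq> {..<b}"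
begin

definition chain :: "nat \<Rightarrow> nat list" where
  "chain v = v # map ((+) n) (sorted_list_of_set (F v)) @ [n + b]"

text \<open>Position of the marker color. It is at least 1 even for empty \<open>F v\<close>, so the
  clique vertex is never itself the marker vertex.\<close>

definition last_pos :: "nat \<Rightarrow> nat" where "last_pos v = Suc (card (F v))"

definition color :: "nat \<Rightarrow> nat" where
  "color x = (case prod_decode x of (v, y) \<Rightarrow>
     (case sum_decode y of Inl j \<Rightarrow> chain v ! j | Inr w \<Rightarrow> \<phi> w))"

definition branch :: "nat \<Rightarrow> nat set" where
  "branch v = chn v ` {..last_pos v} \<union> cpy v ` V"

definition verts' :: "nat set" where "verts' = (\<Union>v<n. branch v)"

inductive_set edges' :: "(nat \<times> nat) set" where
  clique: "v < n \<Longrightarrow> w < n \<Longrightarrow> v \<noteq> w \<Longrightarrow> (chn v 0, chn w 0) \<in> edges'"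
| down: "v < n \<Longrightarrow> j < last_pos v \<Longrightarrow> (chn v j, chn v (Suc j)) \<in> edges'"
| up: "v < n \<Longrightarrow> j < last_pos v \<Longrightarrow> (chn v (Suc j), chn v j) \<in> edges'"
| enter: "v < n \<Longrightarrow> (chn v (last_pos v), cpy v root) \<in> edges'"
| leave: "v < n \<Longrightarrow> (cpy v root, chn v (last_pos v)) \<in> edges'"
| copy: "v < n \<Longrightarrow> (x, y) \<in> E \<Longrightarrow> (cpy v x, cpy v y) \<in> edges'"

lemma color_simps [simp]: "color (chn v j) = chain v ! j" "color (cpy v w) = \<phi> w"
  by (simp_all add: color_def chn_def cpy_def)

lemma finite_F: "v < n \<Longrightarrow> finite (F v)"
  using F_sub finite_subset by blast

lemma length_chain: "v < n \<Longrightarrow> length (chain v) = Suc (last_pos v)"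
  by (simp add: chain_def last_pos_def)

lemma set_chain: "v < n \<Longrightarrow> set (chain v) = insert v (insert (n + b) ((+) n ` F v))"
  using finite_F by (auto simp: chain_def)

lemma chain_0 [simp]: "chain v ! 0 = v"
  by (simp add: chain_def)

lemma chain_last [simp]: "chain v ! last_pos v = n + b"
  by (simp add: chain_def last_pos_def nth_append)

lemma distinct_chain: "v < n \<Longrightarrow> distinct (chain v)"
  using finite_F F_sub by (force simp: chain_def distinct_map)

lemma chain_nth_eq_iff:
  "v < n \<Longrightarrow> i \<le> last_pos v \<Longrightarrow> j \<le> last_pos v \<Longrightarrow> chain v ! i = chain v ! j \<longleftrightarrow> i = j"
  by (simp add: distinct_chain length_chain nth_eq_iff_index_eq)

lemma chain_nth_ge: "v < n \<Longrightarrow> 0 < j \<Longrightarrow> j \<le> last_pos v \<Longrightarrow> n \<le> chain v ! j"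
proof -
  assume a: "v < n" "0 < j" "j \<le> last_pos v"
  then have "chain v ! j \<in> set (chain v)" by (simp add: length_chain)
  moreover have "chain v ! j \<noteq> v" using chain_nth_eq_iff[of v j 0] a by simp
  ultimately show ?thesis using a by (auto simp: set_chain)
qed

lemma last_pos_pos [simp]: "0 < last_pos v"
  by (simp add: last_pos_def)

lemma verts'_cases:
  assumes "x \<in> verts'"
  obtains v j where "x = chn v j" "v < n" "j \<le> last_pos v" | v w where "x = cpy v w" "v < n" "w \<in> V"
  using assms by (auto simp: verts'_def branch_def)

lemma chn_in_branch [simp]: "chn v j \<in> branch w \<longleftrightarrow> v = w \<and> j \<le> last_pos v"
  and cpy_in_branch [simp]: "cpy v x \<in> branch w \<longleftrightarrow> v = w \<and> x \<in> V"
  by (auto simp: branch_def)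

lemma branch_disjoint: "x \<in> branch v \<Longrightarrow> x \<in> branch w \<Longrightarrow> v = w"
  by (auto simp: branch_def)

lemma finite_verts': "finite verts'"
  using finite_V by (auto simp: verts'_def branch_def)

lemma edges'_sub: "edges' \<subseteq> verts' \<times> verts'"
  using E_sub root by (auto simp: verts'_def elim!: edges'.cases)

lemma sym_edges': "sym edges'"
  using sym_E by (auto simp: sym_def intro: edges'.intros elim!: edges'.cases)

lemma irrefl_edges': "irrefl edges'"
  using irrefl_E by (auto simp: irrefl_def elim!: edges'.cases)

section \<open>Gates of branches, chain tails and copies\<close>

lemma edges'_exit_branch:
  "(x, y) \<in> edges' \<Longrightarrow> x \<in> branch v \<Longrightarrow> y \<notin> branch v \<Longrightarrow> x = chn v 0"
  using E_sub root by (auto elim!: edges'.cases)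

text \<open>The chain from position \<open>j\<close> on, together with the copy, is attached to
  everything else through \<open>chn v j\<close> alone. Cutting at every \<open>j\<close> forces a
  path from the marker vertex out of the branch to run over the whole chain.\<close>

lemma edges'_exit_tail:
  "(x, y) \<in> edges' \<Longrightarrow> x \<in> branch v - chn v ` {..<j} \<Longrightarrow> y \<notin> branch v - chn v ` {..<j} \<Longrightarrow> j \<le> last_pos v
   \<Longrightarrow> x = chn v j"
  using E_sub root by (auto elim!: edges'.cases)

lemma edges'_enter_copy:
  "(x, y) \<in> edges' \<Longrightarrow> x \<notin> cpy v ` V \<Longrightarrow> y \<in> cpy v ` V \<Longrightarrow> x = chn v (last_pos v)"
  using E_sub root by (auto elim!: edges'.cases)

lemma colors': "color ` verts' \<subseteq> {..<n + b + 1}"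
proof
  fix c assume "c \<in> color ` verts'"
  then obtain x where x: "x \<in> verts'" "c = color x" by blast
  from x(1) show "c \<in> {..<n + b + 1}"
  proof (cases rule: verts'_cases)
    case (1 v j)
    then have "chain v ! j \<in> set (chain v)" by (simp add: length_chain)
    then show ?thesis using 1 x(2) F_sub[of v] by (auto simp: set_chain)
  next
    case (2 v w)
    then show ?thesis using x(2) colors by force
  qed
qed

section \<open>The extended coloring is linear\<close>

text \<open>Of three such vertices in different branches, the middle one on the path must be both
  reached and left through the gate of its branch. The path visits that gate only once, so the
  middle vertex would be the gate itself, which is excluded.\<close>

lemma path_meets_two_branches:
  assumes p: "distinct p" "successively (\<lambda>x y. (x, y) \<in> edges') p" "set p \<subseteq> verts'"
    and xyz: "x \<in> set p" "y \<in> set p" "z \<in> set p"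
    and br: "x \<in> branch u - {chn u 0}" "y \<in> branch v - {chn v 0}" "z \<in> branch w - {chn w 0}"
    and "u \<noteq> v" "u \<noteq> w"
  shows "v = w"
proof (rule ccontr)
  assume "v \<noteq> w"
  \<comment> \<open>Stated for arbitrary positions and branches, so that each of the six orders of
    \<open>x\<close>, \<open>y\<close>, \<open>z\<close> on the path is an instance.\<close>
  have middle: False
    if ijk: "i < j" "j < k" "k < length p" and at: "p ! i \<in> branch u'" "p ! j \<in> branch v' - {chn v' 0}"
      "p ! k \<in> branch w'" and ne: "u' \<noteq> v'" "v' \<noteq> w'" for i j k u' v' w'
  proof -
    have "\<exists>l. j \<le> l \<and> l < k \<and> p ! l = chn v' 0"
      using successively_crosses[OF p(2) ijk(2,3), of "branch v'" "chn v' 0"] at ne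
        branch_disjoint edges'_exit_branch by blast
    moreover have "\<exists>l. i < l \<and> l \<le> j \<and> p ! l = chn v' 0"
      by (rule successively_crosses_back[OF p(2) ijk(1), of "branch v'"])
        (use ijk at ne branch_disjoint edges'_exit_branch sym_edges' in \<open>auto dest: symD\<close>)
    ultimately obtain l m where lm: "j \<le> l" "l < k" "p ! l = chn v' 0" "i < m" "m \<le> j" "p ! m = chn v' 0"
      by blast
    then have "l = m" using p(1) ijk nth_eq_iff_index_eq[of p l m] by auto
    then have "l = j" using lm by simp
    then show False using lm at by auto
  qed
  from xyz obtain i j k where ijk: "i < length p" "j < length p" "k < length p"
    "p ! i = x" "p ! j = y" "p ! k = z"
    by (metis in_set_conv_nth)
  have "i \<noteq> j" "j \<noteq> k" "i \<noteq> k"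
    using ijk br \<open>u \<noteq> v\<close> \<open>u \<noteq> w\<close> \<open>v \<noteq> w\<close> branch_disjoint by (metis DiffD1)+
  then consider "i < j \<and> j < k" | "k < j \<and> j < i" | "j < i \<and> i < k" | "k < i \<and> i < j"
    | "i < k \<and> k < j" | "j < k \<and> k < i"
    by linarith
  then show False
    using br \<open>u \<noteq> v\<close> \<open>u \<noteq> w\<close> \<open>v \<noteq> w\<close> ijk
    by cases (metis DiffD1 middle)+
qed

text \<open>The tail of the branch from \<open>j\<close> on contains the marker vertex but not
  \<open>y\<close>, so its gate \<open>chn v j\<close> lies on the path.\<close>

lemma path_contains_chain:
  assumes p: "successively (\<lambda>x y. (x, y) \<in> edges') p"
    and "chn v (last_pos v) \<in> set p" "y \<in> set p" "y \<notin> branch v" "j \<le> last_pos v"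
  shows "chn v j \<in> set p"
proof (rule successively_separator[OF p, where C = "branch v - chn v ` {..<j}"
      and x = "chn v (last_pos v)" and y = y])
  show "symp (\<lambda>x y. (x, y) \<in> edges')" using sym_edges' by (auto simp: symp_def sym_def)
  show "chn v (last_pos v) \<in> branch v - chn v ` {..<j}" using assms(5) by auto
  show "x = chn v j" if "(x, y) \<in> edges'" "x \<in> branch v - chn v ` {..<j}"
    "y \<notin> branch v - chn v ` {..<j}" for x y
    using edges'_exit_tail that assms(5) by blast
qed (use assms in auto)

lemma linear': "linear_on verts' edges' color"
  unfolding linear_on_def
proof (intro allI impI)
  fix p assume p: "p \<noteq> []" "distinct p" "set p \<subseteq> verts'" "successively (\<lambda>x y. (x, y) \<in> edges') p"
  have symp: "symp (\<lambda>x y. (x, y) \<in> edges')" using sym_edges' by (auto simp: symp_def sym_def)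
  have copy_color: "\<phi> w < n" if "w \<in> V" for w using colors that by auto
  \<comment> \<open>The path stays in one copy, or it meets at least two marker vertices, exactly
    one, or none while sticking out of every copy.\<close>
  consider (inside) v where "v < n" "set p \<subseteq> cpy v ` V"
    | (two) v w where "v < n" "w < n" "v \<noteq> w" "chn v (last_pos v) \<in> set p" "chn w (last_pos w) \<in> set p"
    | (one) v where "v < n" "chn v (last_pos v) \<in> set p"
        "\<And>w. w < n \<Longrightarrow> chn w (last_pos w) \<in> set p \<Longrightarrow> w = v"
    | (none) "\<And>v. v < n \<Longrightarrow> chn v (last_pos v) \<notin> set p" "\<And>v. v < n \<Longrightarrow> \<not> set p \<subseteq> cpy v ` V"
    by blast
  then show "\<exists>v. is_center color (set p) v"
  proof cases
    case inside
    then obtain q where q: "set p = cpy v ` set q" "p = map (cpy v) q" "set q \<subseteq> V"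
    proof -
      have "p = map (cpy v) (map (inv_into V (cpy v)) p)"
        using inside by (auto simp: map_idI f_inv_into_f subset_iff intro!: map_idI[symmetric])
      moreover have "set (map (inv_into V (cpy v)) p) \<subseteq> V"
        using inside by (auto intro: inv_into_into)
      ultimately show thesis using that by (metis set_map)
    qed
    have "successively (\<lambda>x y. (x, y) \<in> E) q"
      using p(4) unfolding q(2) successively_map
      by (rule successively_mono) (auto elim: edges'.cases)
    moreover have "distinct q" "q \<noteq> []" using p q(2) by (auto simp: distinct_map)
    ultimately obtain w where "is_center \<phi> (set q) w"
      using linear q(3) unfolding linear_on_def by blast
    then have "is_center color (set p) (cpy v w)"
      unfolding q(1) is_center_def by auto
    then show ?thesis ..
  next
    case two
    \<comment> \<open>A color of one subset that is missing from the other gives a center. The claim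
      is asymmetric and used for both orders of \<open>v\<close> and \<open>w\<close>, since the
      distinguishing color may come from either side.\<close>
    have diff: "\<exists>v. is_center color (set p) v"
      if vw: "v < n" "w < n" "v \<noteq> w" "chn v (last_pos v) \<in> set p" "chn w (last_pos w) \<in> set p"
        and l: "l \<in> F v" "l \<notin> F w" for v w l
    proof -
      have "n + l \<in> set (chain v)" using vw l by (simp add: set_chain)
      then obtain j where j: "j \<le> last_pos v" "chain v ! j = n + l"
        using length_chain[OF vw(1)] by (metis in_set_conv_nth less_Suc_eq_le)
      have "chn v j \<in> set p"
        using path_contains_chain[OF p(4) vw(4,5)] vw(3) j by auto
      moreover have "x = chn v j" if x: "x \<in> set p" "color x = color (chn v j)" for x
        using p(3)[THEN subsetD, OF x(1)]
      proof (cases rule: verts'_cases)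
        case (2 u y)
        then show ?thesis using x copy_color[of y] j by simp
      next
        case (1 u i)
        \<comment> \<open>Clique colors are below \<open>n\<close>, so \<open>x\<close> is off the
          clique. The chain of \<open>w\<close> lacks the color \<open>n + l\<close>, and the path
          already meets the branches of \<open>v\<close> and \<open>w\<close>, so only the branch of
          \<open>v\<close> remains.\<close>
        have "i \<noteq> 0" using 1 x j vw by (intro notI) simp
        moreover have "n + l \<noteq> chain w ! i" if "i \<le> last_pos w"
          using that vw l F_sub[OF vw(1)] length_chain[OF vw(2)] nth_mem[of i "chain w"] by (auto simp: set_chain)
        then have "u \<noteq> w" using 1 x j by auto
        ultimately have "u = v"
          using path_meets_two_branches[OF p(2,4,3) vw(5) x(1) vw(4), of w u v] 1 vw by auto
        then show ?thesis using 1 x j vw chain_nth_eq_iff[of v i j] by simp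
      qed
      ultimately show ?thesis unfolding is_center_def by blast
    qed
    have "F v \<noteq> F w" using inj_F two by (auto simp: inj_on_def)
    then obtain l where "l \<in> F v \<and> l \<notin> F w \<or> l \<in> F w \<and> l \<notin> F v" by blast
    then show ?thesis using diff two by metis
  next
    case one
    have "x = chn v (last_pos v)" if x: "x \<in> set p" "color x = n + b" for x
      using p(3)[THEN subsetD, OF x(1)]
    proof (cases rule: verts'_cases)
      case (1 u j)
      then have "j = last_pos u" using x chain_nth_eq_iff[of u j "last_pos u"] by simp
      then show ?thesis using 1 x one by auto
    next
      case (2 u w)
      then show ?thesis using x copy_color[of w] by simp
    qed
    then have "is_center color (set p) (chn v (last_pos v))"
      using one(2) unfolding is_center_def color_simps chain_last by blast
    then show ?thesis ..
  next
    case none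
    \<comment> \<open>Copies reuse colors below \<open>n\<close>, so they must be ruled out before a
      clique vertex can serve as center. A path that meets a copy without staying in it passes the
      marker vertex.\<close>
    have no_copy: "set p \<inter> cpy v ` V = {}" if "v < n" for v
    proof (rule ccontr)
      assume "set p \<inter> cpy v ` V \<noteq> {}"
      then obtain y where y: "y \<in> set p" "y \<in> cpy v ` V" by blast
      from none(2)[OF that] obtain x where x: "x \<in> set p" "x \<notin> cpy v ` V" by blast
      have "chn v (last_pos v) \<in> set p"
        by (rule successively_separator[OF p(4) symp x(1) y(1), where C = "- (cpy v ` V)"])
          (use x y edges'_enter_copy in auto)
      with none(1) that show False by blast
    qed
    have on_chain: "\<exists>v j. x = chn v j \<and> v < n \<and> j \<le> last_pos v" if "x \<in> set p" for x
      using p(3)[THEN subsetD, OF that] no_copy that by (cases rule: verts'_cases) blast+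
    show ?thesis
    proof (cases "\<exists>v. chn v 0 \<in> set p")
      case True
      then obtain v where v: "chn v 0 \<in> set p" by blast
      then have "v < n" using on_chain by (metis chn_cpy_simps(1))
      have "x = chn v 0" if x: "x \<in> set p" "color x = v" for x
      proof -
        obtain u j where u: "x = chn u j" "u < n" "j \<le> last_pos u" using on_chain x(1) by blast
        then have "j = 0" using chain_nth_ge[of u j] x \<open>v < n\<close> by (cases j) auto
        then show ?thesis using u x by simp
      qed
      then have "is_center color (set p) (chn v 0)"
        using v unfolding is_center_def color_simps chain_0 by blast
      then show ?thesis ..
    next
      case False
      \<comment> \<open>Without clique vertices the path stays on the chain of a single branch,
        where all colors differ. Any vertex is then a center; the head is taken.\<close>
      have hd: "hd p \<in> set p" using p(1) by simp
      then obtain v j where v: "hd p = chn v j" "v < n" "j \<le> last_pos v" using on_chain by blast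
      have "x = hd p" if x: "x \<in> set p" "color x = color (hd p)" for x
      proof -
        have "x \<in> branch v"
        proof (rule ccontr)
          assume "x \<notin> branch v"
          then have "chn v 0 \<in> set p"
            by (intro successively_separator[OF p(4) symp hd x(1), where C = "branch v"])
              (use v edges'_exit_branch in auto)
          then show False using False by blast
        qed
        then obtain i where "x = chn v i" "i \<le> last_pos v" using on_chain[OF x(1)] by auto
        then show ?thesis using x v chain_nth_eq_iff[of v i j] by simp
      qed
      then have "is_center color (set p) (hd p)" using hd unfolding is_center_def by blast
      then show ?thesis ..
    qed
  qed
qed

section \<open>Centered colorings of the extended graph\<close>

text \<open>Clique edges join the branches at their tops, so connectivity survives the deletion of
  branches on which the counting rests.\<close>

lemma connected_in_branches:
  assumes "I \<noteq> {}" "I \<subseteq> {..<n}"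
  shows "connected_in edges' (\<Union>v\<in>I. branch v)"
proof -
  let ?U = "\<Union>v\<in>I. branch v"
  let ?R = "(edges' \<inter> ?U \<times> ?U)\<^sup>*"
  obtain r where r: "r \<in> I" using assms by blast
  have top: "(chn v 0, chn r 0) \<in> ?R" if "v \<in> I" for v
    using that r assms by (cases "v = r") (auto intro!: r_into_rtrancl edges'.clique)
  have chn: "(chn v j, chn v 0) \<in> ?R" if "v \<in> I" "j \<le> last_pos v" for v j
    using that(2)
  proof (induction j)
    case (Suc j)
    have "(chn v (Suc j), chn v j) \<in> edges' \<inter> ?U \<times> ?U"
      using Suc.prems that(1) assms by (auto intro!: edges'.up)
    then show ?case using Suc by (meson Suc_leD converse_rtrancl_into_rtrancl)
  qed simp
  have walk: "(cpy v w, cpy v y) \<in> ?R" if "(w, y) \<in> (E \<inter> V \<times> V)\<^sup>*" "v \<in> I" for v w y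
    using that(1)
  proof (induction rule: rtrancl_induct)
    case (step y z)
    then have "(cpy v y, cpy v z) \<in> edges' \<inter> ?U \<times> ?U"
      using that assms by (auto intro!: edges'.copy)
    with step.IH show ?case by (rule rtrancl_into_rtrancl)
  qed simp
  have cpy: "(cpy v w, cpy v root) \<in> ?R" if "v \<in> I" "w \<in> V" for v w
    using walk that connected_V root by (auto simp: connected_in_def)
  have leave: "(cpy v root, chn v (last_pos v)) \<in> ?R" if "v \<in> I" for v
    using that assms root by (auto intro!: r_into_rtrancl edges'.leave)
  show ?thesis
  proof (rule connected_in_via[OF sym_edges', of "chn r 0"])
    show "chn r 0 \<in> ?U" using r by auto
    fix x assume "x \<in> ?U"
    then obtain v where v: "v \<in> I" "x \<in> branch v" by blast
    then consider j where "x = chn v j" "j \<le> last_pos v" | w where "x = cpy v w" "w \<in> V"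
      by (auto simp: branch_def)
    then have "(x, chn v 0) \<in> ?R"
      using chn cpy leave v(1) by cases (blast intro: rtrancl_trans)+
    then show "(x, chn r 0) \<in> ?R" using top[OF v(1)] by (rule rtrancl_trans)
  qed
qed

lemma centered_on_copy:
  assumes "centered_on verts' edges' \<psi>" "v < n"
  shows "centered_on V E (\<psi> \<circ> cpy v)"
  unfolding centered_on_def
proof (intro allI impI)
  fix X assume X: "X \<subseteq> V" "connected_in E X"
  let ?R = "edges' \<inter> (cpy v ` X) \<times> (cpy v ` X)"
  have "(cpy v x, cpy v y) \<in> ?R\<^sup>*" if "(x, y) \<in> (E \<inter> X \<times> X)\<^sup>*" for x y
    using that
  proof (induction rule: rtrancl_induct)
    case (step y z)
    then have "(cpy v y, cpy v z) \<in> ?R" using assms(2) by (auto intro: edges'.copy)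
    with step.IH show ?case by (rule rtrancl_into_rtrancl)
  qed simp
  then have "connected_in edges' (cpy v ` X)"
    using X(2) by (auto simp: connected_in_def)
  moreover have "cpy v ` X \<subseteq> verts'" using X(1) assms(2) by (auto simp: verts'_def)
  ultimately obtain u where "is_center \<psi> (cpy v ` X) u"
    using assms(1) unfolding centered_on_def by blast
  then show "\<exists>x. is_center (\<psi> \<circ> cpy v) X x" unfolding is_center_def by auto
qed

text \<open>The center of the union has a color that occurs nowhere else, so deleting its branch
  loses at least one color. After \<open>m\<close> deletions a single branch is left; it contains a
  copy, which still needs \<open>L\<close> colors.\<close>

lemma card_branches_ge:
  assumes \<psi>: "centered_on verts' edges' \<psi>"
    and L: "\<And>\<psi> :: nat \<Rightarrow> nat. centered_on V E \<psi> \<Longrightarrow> L \<le> card (\<psi> ` V)"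
    and I: "card I = Suc m" "I \<subseteq> {..<n}"
  shows "L + m \<le> card ((\<psi> :: nat \<Rightarrow> nat) ` (\<Union>v\<in>I. branch v))"
  using I
proof (induction m arbitrary: I)
  case 0
  then obtain v where v: "I = {v}" "v < n" by (auto simp: card_Suc_eq)
  have "L \<le> card ((\<psi> \<circ> cpy v) ` V)" using L centered_on_copy[OF \<psi> v(2)] .
  also have "\<dots> \<le> card (\<psi> ` branch v)"
    by (rule card_mono) (auto simp: branch_def finite_V)
  finally show ?case using v by simp
next
  case (Suc m)
  let ?U = "\<lambda>I. \<Union>v\<in>I. branch v"
  have fin: "finite (?U I)" and sub: "?U I \<subseteq> verts'"
    using Suc.prems finite_subset[OF _ finite_verts', of "?U I"] by (auto simp: verts'_def)
  have "I \<noteq> {}" using Suc.prems by auto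
  then obtain u where u: "is_center \<psi> (?U I) u"
    using \<psi> sub connected_in_branches Suc.prems unfolding centered_on_def by blast
  then obtain v where v: "v \<in> I" "u \<in> branch v" unfolding is_center_def by blast
  let ?J = "I - {v}"
  have "\<psi> u \<notin> \<psi> ` ?U ?J"
  proof
    assume "\<psi> u \<in> \<psi> ` ?U ?J"
    then obtain x where x: "\<psi> u = \<psi> x" "x \<in> ?U ?J" by (rule imageE)
    then obtain w where "w \<in> I" "w \<noteq> v" "x \<in> branch w" by blast
    then show False using u v branch_disjoint x(1) unfolding is_center_def by (metis UN_I)
  qed
  moreover have "finite (\<psi> ` ?U ?J)" by (intro finite_imageI finite_subset[OF _ fin]) auto
  ultimately have "Suc (card (\<psi> ` ?U ?J)) = card (insert (\<psi> u) (\<psi> ` ?U ?J))" by simp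
  also have "\<dots> \<le> card (\<psi> ` ?U I)"
    using fin v by (intro card_mono) auto
  finally have "Suc (card (\<psi> ` ?U ?J)) \<le> card (\<psi> ` ?U I)" .
  moreover have "card ?J = Suc m" using Suc.prems v by simp
  ultimately show ?case using Suc.IH[of ?J] Suc.prems by fastforce
qed

end

section \<open>Iterating the construction\<close>

lemma realizes_step:
  assumes "realizes n L" "n \<le> 2 ^ b"
  shows "realizes (n + b + 1) (L + n - 1)"
proof -
  from assms(1) obtain V :: "nat set" and E \<phi> where
    G: "finite V" "E \<subseteq> V \<times> V" "sym E" "irrefl E" "connected_in E V" "\<phi> ` V \<subseteq> {..<n}" "linear_on V E \<phi>"
    and L: "\<And>\<psi> :: nat \<Rightarrow> nat. centered_on V E \<psi> \<Longrightarrow> L \<le> card (\<psi> ` V)"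
    unfolding realizes_def by blast
  then obtain root where root: "root \<in> V" by (auto simp: connected_in_def)
  \<comment> \<open>The color of \<open>root\<close> is below \<open>n\<close>, so \<open>n\<close>
    is positive and the subtraction in \<open>L + n - 1\<close> is not truncated; \<open>m\<close>
    counts the deletions.\<close>
  then obtain m where m: "n = Suc m" using G(6) by (cases n) auto
  have "card {..<n} \<le> card (Pow {..<b})" using assms(2) by (simp add: card_Pow)
  then obtain F where F: "inj_on F {..<n}" "F ` {..<n} \<subseteq> Pow {..<b}"
    using card_le_inj[of "{..<n}" "Pow {..<b}"] by auto
  interpret branch_extension V E \<phi> root n b F
    using G root F by unfold_locales auto
  have "connected_in edges' verts'"
    unfolding verts'_def by (rule connected_in_branches) (use m in auto)
  moreover have "L + n - 1 \<le> card (\<psi> ` verts')" if "centered_on verts' edges' \<psi>" for \<psi> :: "nat \<Rightarrow> nat"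
    using card_branches_ge[OF that L, of "{..<n}" m] m unfolding verts'_def by simp
  ultimately show ?thesis
    using finite_verts' edges'_sub sym_edges' irrefl_edges' colors' linear'
    unfolding realizes_def by blast
qed

text \<open>Since \<open>n\<close> may exceed the number of colors in use, the iteration can start
  from any positive value.\<close>

lemma realizes_singleton:
  assumes "0 < n"
  shows "realizes n 1"
proof -
  have "linear_on {0::nat} {} (\<lambda>_. 0::nat)"
    by (auto simp: linear_on_def is_center_def subset_singleton_iff)
  then show ?thesis using assms unfolding realizes_def
    by (intro exI[of _ "{0}"] exI[of _ "{}"] exI[of _ "\<lambda>_. 0"]) (auto simp: connected_in_def sym_def irrefl_def)
qed

lemma realizes_mono: "realizes n L \<Longrightarrow> L' \<le> L \<Longrightarrow> realizes n L'"
  unfolding realizes_def by (meson le_trans)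

text \<open>One \<open>b\<close> serves all levels, as the final number of colors bounds the earlier
  ones. The step from \<open>m + i * (b + 1)\<close> colors raises the lower bound by
  \<open>m + i * (b + 1) - 1\<close>, which is at least \<open>i * (b + 1)\<close>.\<close>

lemma realizes_iterate:
  assumes "0 < m" "m + h * (b + 1) \<le> 2 ^ b"
  shows "realizes (m + h * (b + 1)) (1 + (b + 1) * (\<Sum>i<h. i))"
  using assms(2)
proof (induction h)
  case 0
  then show ?case using realizes_singleton[OF assms(1)] by simp
next
  case (Suc h)
  then have "realizes (m + h * (b + 1)) (1 + (b + 1) * (\<Sum>i<h. i))" by simp
  from realizes_step[OF this, of b] show ?case
    using Suc.prems assms(1) by (auto elim!: realizes_mono simp: algebra_simps)
qed

section \<open>Transfer to \<open>pair_graph\<close>s\<close>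

text \<open>Makes \<open>centered_coloring\<close> applicable to connected vertex sets, through the
  subgraphs that they induce.\<close>

lemma induced_connected:
  assumes "pair_graph G" "X \<subseteq> pverts G" "connected_in (parcs G) X"
  defines "H \<equiv> \<lparr>pverts = X, parcs = parcs G \<inter> X \<times> X\<rparr>"
  shows "pair_graph H" "subgraph (with_proj H) (with_proj G)" "Digraph_Component.connected (with_proj H)"
proof -
  interpret pair_graph G by fact
  interpret H: pair_graph H
  proof
    show "finite (pverts H)" "finite (parcs H)"
      using assms(2) by (auto simp: H_def intro: finite_subset)
    show "symmetric (with_proj H)"
      using graph_symmetric by (auto simp: H_def symmetric_def sym_def arcs_ends_def)
  qed (use no_loops in \<open>auto simp: H_def\<close>)
  show H: "pair_graph H" by unfold_locales
  show "subgraph (with_proj H) (with_proj G)"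
    by (rule subgraphI) (use assms(2) H.wf_digraph wf_digraph in \<open>auto simp: H_def compatible_def\<close>)
  have "x \<rightarrow>\<^sup>*\<^bsub>with_proj H\<^esub> y" if "x \<in> X" "y \<in> X" for x y
  proof -
    have "(x, y) \<in> (parcs H)\<^sup>*" using assms(3) that by (simp add: connected_in_def H_def)
    then show ?thesis
    proof (induction rule: rtrancl_induct)
      case base
      then show ?case using that H.reachable_refl by (simp add: H_def)
    next
      case (step y z)
      then show ?case by (auto intro: H.reachable_adj_trans)
    qed
  qed
  then show "Digraph_Component.connected (with_proj H)"
    using assms(3) H.reachable_mk_symmetricI
    by (auto simp: Digraph_Component.connected_def strongly_connected_def connected_in_def H_def)
qed

lemma successively_vwalk_arcs: "set (vwalk_arcs p) \<subseteq> E \<Longrightarrow> successively (\<lambda>x y. (x, y) \<in> E) p"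
  by (induction p rule: vwalk_arcs.induct) auto

text \<open>The given linear coloring bounds the minimum \<open>chi_lin\<close>; the minimum
  \<open>chi_cen\<close> is attained by some coloring, to which the lower bound \<open>L\<close>
  applies.\<close>

lemma realizes_imp_pair_graph:
  assumes "realizes n L"
  obtains G :: "nat pair_pre_digraph" where "pair_graph G" "chi_lin G \<le> n" "L \<le> chi_cen G"
proof -
  from assms obtain V :: "nat set" and E \<phi> where
    G: "finite V" "E \<subseteq> V \<times> V" "sym E" "irrefl E" "\<phi> ` V \<subseteq> {..<n}" "linear_on V E \<phi>"
    and L: "\<And>\<psi> :: nat \<Rightarrow> nat. centered_on V E \<psi> \<Longrightarrow> L \<le> card (\<psi> ` V)"
    unfolding realizes_def by blast
  define G where "G = \<lparr>pverts = V, parcs = E\<rparr>"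
  have pg: "pair_graph G"
  proof
    show "finite (parcs G)" using G by (simp add: G_def finite_subset)
    show "symmetric (with_proj G)" using G(3) by (auto simp: G_def symmetric_def arcs_ends_def)
  qed (use G in \<open>auto simp: G_def irrefl_def\<close>)
  have "linear_coloring G \<phi>"
    unfolding linear_coloring_def
  proof (intro allI impI)
    fix p assume p: "vpath p (with_proj G)"
    have "p \<noteq> []" "distinct p" "set p \<subseteq> V" "successively (\<lambda>x y. (x, y) \<in> E) p"
      using p by (auto simp: vpath_def vwalk_def G_def successively_vwalk_arcs)
    then show "\<exists>v. is_center \<phi> (set p) v" using G(6) unfolding linear_on_def by blast
  qed
  then have "chi_lin G \<le> card (\<phi> ` V)"
    unfolding chi_lin_def by (intro Least_le) (auto simp: G_def)
  also have "\<dots> \<le> n" using card_mono[OF _ G(5)] by simp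
  finally have lin: "chi_lin G \<le> n" .
  obtain \<psi> :: "nat \<Rightarrow> nat" where \<psi>: "centered_coloring G \<psi>" "card (\<psi> ` pverts G) = chi_cen G"
    using chi_cen_attained[of G] G(1) by (auto simp: G_def)
  have "centered_on V E \<psi>"
    unfolding centered_on_def
  proof (intro allI impI)
    fix X assume X: "X \<subseteq> V" "connected_in E X"
    then show "\<exists>v. is_center \<psi> X v"
      using \<psi>(1) induced_connected[OF pg, of X] unfolding centered_coloring_def
      by (fastforce simp: G_def)
  qed
  then have "L \<le> chi_cen G" using L[of \<psi>] \<psi>(2) by (simp add: G_def)
  with pg lin show thesis by (rule that)
qed

section \<open>Choice of parameters and asymptotics\<close>

lemma realizes_quadratic:
  assumes "1 \<le> k"
  defines "b \<equiv> nat \<lceil>log 2 (real k)\<rceil>"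
  defines "h \<equiv> (k - 1) div (b + 1)"
  shows "realizes k (1 + (b + 1) * (\<Sum>i<h. i))"
proof -
  have "real k = 2 powr log 2 (real k)" using assms(1) by simp
  also have "\<dots> \<le> 2 powr real b" by (intro powr_mono) (auto simp: b_def intro: real_nat_ceiling_ge)
  also have "\<dots> = real (2 ^ b)" by (simp add: powr_realpow)
  finally have "k \<le> 2 ^ b" by linarith
  \<comment> \<open>Starting with one color plus the remainder lets the iteration end at exactly
    \<open>k\<close>, so every positive \<open>k\<close> is reached.\<close>
  moreover have "1 + (k - 1) mod (b + 1) + h * (b + 1) = k"
    using assms(1) unfolding h_def by (metis add.assoc add.commute le_add_diff_inverse mod_div_mult_eq)
  ultimately show ?thesis
    using realizes_iterate[of "1 + (k - 1) mod (b + 1)" h b] by simp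
qed

text \<open>With \<open>r = b + 1\<close> the right-hand side is
  \<open>(h * r) * ((h - 1) * r) / (2 * r)\<close>. The remainder of the division is below
  \<open>r\<close>, so both factors are at least \<open>k - 1 - 2 * r\<close>, and this is
  nonnegative by the second hypothesis.\<close>

lemma sum_lower_bound:
  fixes k b :: nat
  assumes "1 \<le> k" "2 * real (b + 1) + 1 \<le> real k"
  defines "h \<equiv> (k - 1) div (b + 1)"
  shows "(real k - 1 - 2 * real (b + 1)) ^ 2 / (2 * real (b + 1)) \<le> real ((b + 1) * (\<Sum>i<h. i))"
proof -
  define r where "r = real (b + 1)"
  have r: "0 < r" by (simp add: r_def)
  have "real (k - 1) = real (h * (b + 1) + (k - 1) mod (b + 1))"
    by (simp only: h_def div_mult_mod_eq)
  moreover have "real ((k - 1) mod (b + 1)) \<le> r"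
    unfolding r_def of_nat_le_iff by (intro less_imp_le mod_less_divisor) simp
  ultimately have h: "real k - 1 \<le> real h * r + r"
    using assms(1) by (simp add: r_def of_nat_diff algebra_simps)
  then have "real k - 1 - 2 * r \<le> (real h - 1) * r" by (simp add: algebra_simps)
  moreover have "0 \<le> real k - 1 - 2 * r" using assms(2) by (simp add: r_def)
  ultimately have "(real k - 1 - 2 * r) * (real k - 1 - 2 * r) \<le> (real h * r) * ((real h - 1) * r)"
    using r by (intro mult_mono) (auto simp: algebra_simps)
  moreover have "real (\<Sum>i<h. i) = real h * (real h - 1) / 2"
    by (induction h) (auto simp: field_simps)
  then have "real ((b + 1) * (\<Sum>i<h. i)) = (real h * r) * ((real h - 1) * r) / (2 * r)"
    using r unfolding r_def[symmetric] of_nat_mult by simp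
  ultimately show ?thesis
    using r unfolding r_def[symmetric] power2_eq_square by (metis divide_right_mono less_imp_le mult_pos_pos zero_less_numeral)
qed

theorem theorem1:
  shows "\<exists>(G :: nat \<Rightarrow> nat pair_pre_digraph) (x :: nat \<Rightarrow> nat) (\<epsilon> :: nat \<Rightarrow> real).
     (\<forall>k\<ge>1. pair_graph (G k)) \<and>
     (\<forall>k\<ge>1. x k > 0) \<and>
     strict_mono_on {1..} x \<and>
     \<not> bdd_above (x ` {1..}) \<and>
     (\<lambda>k. real (x (k + 1)) / real (x k)) \<longlonglongrightarrow> 1 \<and>
     \<epsilon> \<longlonglongrightarrow> 0 \<and>
     (\<forall>k\<ge>1. chi_lin (G k) \<le> x k) \<and>
     (\<forall>k\<ge>1. x k > 1 \<longrightarrow>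
        real (chi_cen (G k)) \<ge> (1 / 2 - \<epsilon> k) * (real (x k) ^ 2 / log 2 (real (x k))))"
proof -
  define b where "b k = nat \<lceil>log 2 (real k)\<rceil>" for k
  define L where "L k = 1 + (b k + 1) * (\<Sum>i<(k - 1) div (b k + 1). i)" for k
  have "\<exists>G :: nat pair_pre_digraph. pair_graph G \<and> chi_lin G \<le> k \<and> L k \<le> chi_cen G" if "1 \<le> k" for k
    using realizes_imp_pair_graph[OF realizes_quadratic[OF that]] unfolding L_def b_def by metis
  then obtain G :: "nat \<Rightarrow> nat pair_pre_digraph"
    where G: "\<And>k. 1 \<le> k \<Longrightarrow> pair_graph (G k) \<and> chi_lin (G k) \<le> k \<and> L k \<le> chi_cen (G k)"
    by metis
  \<comment> \<open>The bound of \<open>sum_lower_bound\<close> with \<open>b k + 1\<close> replaced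
    by \<open>log 2 y + 2\<close>: one unit for rounding up, one for the marker color. The constant
    5 is 1 + 2 * 2.\<close>
  define f where "f y = (y - 5 - 2 * log 2 y) ^ 2 / (2 * (log 2 y + 2))" for y :: real
  \<comment> \<open>Chosen for the sequence \<open>x k = k\<close> so that the final inequality
    follows from \<open>L k \<le> chi_cen (G k)\<close>; the cut at 0 supplies the lower side of the
    sandwich.\<close>
  define \<epsilon> where "\<epsilon> k = max 0 (1 / 2 - real (L k) * log 2 (real k) / real k ^ 2)" for k :: nat
  have L_ge: "f (real k) \<le> real (L k)" if k: "1 \<le> k" and large: "5 + 2 * log 2 (real k) \<le> real k" for k
  proof -
    let ?r = "real (b k + 1)"
    have lg: "0 \<le> log 2 (real k)" using k by simp
    then have r: "?r \<le> log 2 (real k) + 2" "1 \<le> ?r"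
      by (simp_all add: b_def) linarith
    have "f (real k) \<le> (real k - 1 - 2 * ?r) ^ 2 / (2 * ?r)"
      unfolding f_def using r large by (intro frac_le power_mono) auto
    also have "\<dots> \<le> real (L k)"
      using sum_lower_bound[of k "b k"] k r large by (simp add: L_def)
    finally show ?thesis .
  qed
  have "eventually (\<lambda>k. 5 + 2 * log 2 (real k) \<le> real k) sequentially" by real_asymp
  then have ev: "eventually (\<lambda>k. \<epsilon> k \<le> max 0 (1 / 2 - f (real k) * log 2 (real k) / real k ^ 2)) sequentially"
    using eventually_ge_at_top[of 1]
  proof eventually_elim
    case (elim k)
    then show ?case unfolding \<epsilon>_def
      by (intro max.mono diff_mono divide_right_mono mult_right_mono L_ge) auto
  qed
  \<comment> \<open>Here \<open>f y\<close> is asymptotically \<open>y ^ 2 / (2 * log 2 y)\<close>,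
    so the subtracted quotient tends to 1/2.\<close>
  have "(\<lambda>k. 1 / 2 - f (real k) * log 2 (real k) / real k ^ 2) \<longlonglongrightarrow> 0"
    unfolding f_def by real_asymp
  then have "(\<lambda>k. max 0 (1 / 2 - f (real k) * log 2 (real k) / real k ^ 2)) \<longlonglongrightarrow> max 0 0"
    by (intro tendsto_max tendsto_const)
  then have "(\<lambda>k. max 0 (1 / 2 - f (real k) * log 2 (real k) / real k ^ 2)) \<longlonglongrightarrow> 0"
    by simp
  moreover have "eventually (\<lambda>k. 0 \<le> \<epsilon> k) sequentially" by (simp add: \<epsilon>_def)
  ultimately have \<epsilon>: "\<epsilon> \<longlonglongrightarrow> 0"
    by (intro tendsto_sandwich[OF _ ev tendsto_const])
  have bound: "(1 / 2 - \<epsilon> k) * (real k ^ 2 / log 2 (real k)) \<le> real (chi_cen (G k))" if k: "1 < k" for k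
  proof -
    have lg: "0 < log 2 (real k)" using k by simp
    have "1 / 2 - \<epsilon> k \<le> real (L k) * log 2 (real k) / real k ^ 2" by (simp add: \<epsilon>_def)
    then have "(1 / 2 - \<epsilon> k) * (real k ^ 2 / log 2 (real k)) \<le>
        real (L k) * log 2 (real k) / real k ^ 2 * (real k ^ 2 / log 2 (real k))"
      using lg by (intro mult_right_mono) auto
    also have "\<dots> = real (L k)" using lg[THEN less_imp_neq, THEN not_sym] k by simp
    also have "\<dots> \<le> real (chi_cen (G k))" using G[of k] k by simp
    finally show ?thesis .
  qed
  have "\<not> bdd_above ((\<lambda>k::nat. k) ` {1..})"
    by (simp add: bdd_above_nat infinite_Ici)
  moreover have "(\<lambda>k. real (k + 1) / real k) \<longlonglongrightarrow> 1" by real_asymp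
  ultimately show ?thesis
    using G \<epsilon> bound
    by (intro exI[of _ G] exI[of _ "\<lambda>k. k"] exI[of _ \<epsilon>]) (auto simp: strict_mono_on_def)
qed

end
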